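(* Let $m\geq 2$ and let $M=(m_{ij})$ be a symmetric invertible real $m\times m$ matrix with non-positive off-diagonal elements. Set $C=(c_{ij}):=M^{-1}$. If $M$ is an M-matrix, then $$\frac{1}{2}\sum_{i=1}^m\sum_{j=1}^m|m_{ij}|\,|c_{ik}c_{j\ell}-c_{jk}c_{i\ell}|\leq(m-1)\,c_{k\ell}$$ for all integers $1\leq k,\ell\leq m$ with $k\neq\ell$.
   Context: A real square matrix $M$ with non-positive off-diagonal elements is called an M-matrix if $M$ is non-singular and each entry of $M^{-1}$ is non-negative. *)

theory Defs
  imports "HOL-Analysis.Analysis"
begin

definition nonpos_off_diagonal :: "real ^ 'n ^ 'n \<Rightarrow> bool" where
  "nonpos_off_diagonal M \<longleftrightarrow> (\<forall>i j. i \<noteq> j \<longrightarrow> M $ i $ j \<le> 0)"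

definition M_matrix :: "real ^ 'n ^ 'n \<Rightarrow> bool" where
  "M_matrix M \<longleftrightarrow>
     nonpos_off_diagonal M \<and> invertible M \<and> (\<forall>i j. 0 \<le> matrix_inv M $ i $ j)"

end

theory Submission imports Defs begin

text \<open>
  Write \<open>a\<^sub>i = c\<^sub>i\<^sub>k\<close> and \<open>b\<^sub>i = c\<^sub>i\<^sub>l\<close>, and regard
  \<open>F\<^sub>i\<^sub>j = - m\<^sub>i\<^sub>j (a\<^sub>i b\<^sub>j - a\<^sub>j b\<^sub>i)\<close> as a flow on the edges of the complete graph on the
  index set.  It is antisymmetric because \<open>M\<close> is symmetric, and the left-hand side of the
  theorem is its total mass, each edge being counted once.

  The identity \<open>M C = I\<close> says that the flow is conserved away from \<open>k\<close> and \<open>l\<close>: the net outflow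
  is \<open>b\<^sub>k = c\<^sub>k\<^sub>l\<close> at \<open>k\<close> and \<open>- a\<^sub>l = - c\<^sub>l\<^sub>k\<close> at \<open>l\<close>.  Since \<open>C\<close> is non-negative, no set of
  vertices has a net outflow above \<open>c\<^sub>k\<^sub>l\<close> (lemma \<open>net_outflow_le\<close>).

  The flow is also acyclic.  The points \<open>(a\<^sub>i, b\<^sub>i)\<close> lie in the closed first quadrant, and
  \<open>a\<^sub>i b\<^sub>j - a\<^sub>j b\<^sub>i\<close> is positive only if the direction of the second point is strictly steeper
  than that of the first.  As \<open>- m\<^sub>i\<^sub>j \<ge> 0\<close> for \<open>i \<noteq> j\<close>, the flow always runs towards the steeper
  direction (lemma \<open>cross_product_slope\<close>).

  An acyclic flow of value \<open>c\<close> on \<open>m\<close> vertices has mass at most \<open>(m - 1) c\<close>: cutting the vertices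
  between consecutive levels of the potential gives at most \<open>m - 1\<close> cuts, every edge that carries
  flow crosses some cut, and all flow crosses a cut in the same direction, so that the mass
  crossing it is a net outflow and hence at most \<open>c\<close>
  (lemma \<open>mass_of_flow_along_potential\<close>).
\<close>

section \<open>Flows that follow a potential\<close>

text \<open>Edges inside \<open>S\<close> cancel in pairs.\<close>

lemma net_outflow_eq_flow_across_cut:
  fixes F :: "'a \<Rightarrow> 'a \<Rightarrow> real"
  assumes fin: "finite V" and sub: "S \<subseteq> V"
    and anti: "\<And>i j. i \<in> V \<Longrightarrow> j \<in> V \<Longrightarrow> F j i = - F i j"
  shows "(\<Sum>i\<in>S. \<Sum>j\<in>V. F i j) = (\<Sum>i\<in>S. \<Sum>j\<in>V - S. F i j)"
proof -
  have "(\<Sum>i\<in>S. \<Sum>j\<in>S. F i j) = (\<Sum>i\<in>S. \<Sum>j\<in>S. F j i)"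
    by (rule sum.swap)
  also have "\<dots> = (\<Sum>i\<in>S. \<Sum>j\<in>S. - F i j)"
    using sub by (intro sum.cong refl anti) auto
  also have "\<dots> = - (\<Sum>i\<in>S. \<Sum>j\<in>S. F i j)"
    by (simp add: sum_negf)
  finally have inner: "(\<Sum>i\<in>S. \<Sum>j\<in>S. F i j) = 0"
    by simp
  have "(\<Sum>j\<in>V. F i j) = (\<Sum>j\<in>V - S. F i j) + (\<Sum>j\<in>S. F i j)" for i
    using fin sub by (rule sum.subset_diff[rotated])
  then show ?thesis
    by (simp add: sum.distrib inner)
qed

text \<open>
  Summing over the cuts at all levels but the highest counts every edge that carries flow at
  least once.  The factor \<open>card V - 1\<close> bounds the number of these levels, and \<open>c\<close> the mass at each.
\<close>

lemma mass_of_flow_along_potential: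
  fixes F :: "'a \<Rightarrow> 'a \<Rightarrow> real" and r :: "'a \<Rightarrow> real"
  assumes fin: "finite V" and ne: "V \<noteq> {}"
    and anti: "\<And>i j. i \<in> V \<Longrightarrow> j \<in> V \<Longrightarrow> F j i = - F i j"
    and up: "\<And>i j. i \<in> V \<Longrightarrow> j \<in> V \<Longrightarrow> r i < r j \<Longrightarrow> 0 \<le> F i j"
    and level: "\<And>i j. i \<in> V \<Longrightarrow> j \<in> V \<Longrightarrow> r i = r j \<Longrightarrow> F i j = 0"
    and outflow: "\<And>S. S \<subseteq> V \<Longrightarrow> (\<Sum>i\<in>S. \<Sum>j\<in>V. F i j) \<le> c"
  shows "(1 / 2) * (\<Sum>i\<in>V. \<Sum>j\<in>V. \<bar>F i j\<bar>) \<le> (real (card V) - 1) * c"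
proof -
  \<comment> \<open>A level \<open>t\<close> stands for the cut between the potentials up to \<open>t\<close> and those above it; the
     highest level would give the trivial cut.\<close>
  define T where "T = r ` V - {Max (r ` V)}"
  define G where "G t i j = (if r i \<le> t \<and> t < r j then F i j else 0)" for t i j
  have finT: "finite T"
    using fin by (simp add: T_def)
  have G_nonneg: "0 \<le> G t i j" if "i \<in> V" "j \<in> V" for t i j
    using up[OF that] by (auto simp: G_def)
  have crosses: "F i j \<le> (\<Sum>t\<in>T. G t i j)" if ij: "i \<in> V" "j \<in> V" "r i < r j" for i j
  proof -
    \<comment> \<open>The lower endpoint names a cut that the edge crosses.\<close>
    have "r j \<le> Max (r ` V)"
      using fin ij by simp
    then have "r i \<in> T"
      using ij by (auto simp: T_def)
    moreover have "F i j = G (r i) i j"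
      using ij by (simp add: G_def)
    ultimately show ?thesis
      using member_le_sum[of "r i" T "\<lambda>t. G t i j"] finT G_nonneg ij by simp
  qed
  have edge: "\<bar>F i j\<bar> \<le> (\<Sum>t\<in>T. G t i j) + (\<Sum>t\<in>T. G t j i)"
    if ij: "i \<in> V" "j \<in> V" for i j
  proof -
    have nn: "0 \<le> (\<Sum>t\<in>T. G t i j)" "0 \<le> (\<Sum>t\<in>T. G t j i)"
      using G_nonneg ij by (simp_all add: sum_nonneg)
    consider "r i < r j" | "r j < r i" | "r i = r j"
      by linarith
    then show ?thesis
    proof cases
      case 1
      then show ?thesis
        using crosses[OF ij 1] up[OF ij 1] nn by linarith
    next
      case 2
      then show ?thesis
        using crosses[OF ij(2,1) 2] up[OF ij(2,1) 2] anti[OF ij] nn by linarith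
    next
      case 3
      then show ?thesis
        using level[OF ij 3] nn by simp
    qed
  qed
  have cut: "(\<Sum>i\<in>V. \<Sum>j\<in>V. G t i j) \<le> c" for t
  proof -
    define S where "S = {i \<in> V. r i \<le> t}"
    have S: "S \<subseteq> V"
      by (auto simp: S_def)
    have row: "(\<Sum>j\<in>V. G t i j) = (if i \<in> S then \<Sum>j\<in>V - S. F i j else 0)"
      if "i \<in> V" for i
    proof (cases "i \<in> S")
      case True
      have "(\<Sum>j\<in>V. G t i j) = (\<Sum>j\<in>V - S. F i j)"
        using fin True by (intro sum.mono_neutral_cong_right) (auto simp: G_def S_def)
      then show ?thesis
        using True by simp
    next
      case False
      then show ?thesis
        using that by (auto simp: G_def S_def)
    qed
    have "(\<Sum>i\<in>V. \<Sum>j\<in>V. G t i j) = (\<Sum>i\<in>V. if i \<in> S then \<Sum>j\<in>V - S. F i j else 0)"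
      using row by (rule sum.cong[OF refl])
    also have "\<dots> = (\<Sum>i\<in>S. \<Sum>j\<in>V - S. F i j)"
      using fin S by (simp add: sum.inter_restrict[symmetric] Int_absorb1)
    also have "\<dots> = (\<Sum>i\<in>S. \<Sum>j\<in>V. F i j)"
      using net_outflow_eq_flow_across_cut[OF fin S anti] by simp
    finally show ?thesis
      using outflow[OF S] by simp
  qed
  have "(\<Sum>i\<in>V. \<Sum>j\<in>V. \<bar>F i j\<bar>)
      \<le> (\<Sum>i\<in>V. \<Sum>j\<in>V. (\<Sum>t\<in>T. G t i j) + (\<Sum>t\<in>T. G t j i))"
    using edge by (intro sum_mono)
  also have "\<dots> = (\<Sum>i\<in>V. \<Sum>j\<in>V. \<Sum>t\<in>T. G t i j) + (\<Sum>i\<in>V. \<Sum>j\<in>V. \<Sum>t\<in>T. G t j i)"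
    by (simp add: sum.distrib)
  also have "(\<Sum>i\<in>V. \<Sum>j\<in>V. \<Sum>t\<in>T. G t j i) = (\<Sum>i\<in>V. \<Sum>j\<in>V. \<Sum>t\<in>T. G t i j)"
    by (rule sum.swap)
  also have "(\<Sum>i\<in>V. \<Sum>j\<in>V. \<Sum>t\<in>T. G t i j) = (\<Sum>t\<in>T. \<Sum>i\<in>V. \<Sum>j\<in>V. G t i j)"
  proof -
    have "(\<Sum>i\<in>V. \<Sum>j\<in>V. \<Sum>t\<in>T. G t i j) = (\<Sum>i\<in>V. \<Sum>t\<in>T. \<Sum>j\<in>V. G t i j)"
      by (intro sum.cong refl sum.swap)
    also have "\<dots> = (\<Sum>t\<in>T. \<Sum>i\<in>V. \<Sum>j\<in>V. G t i j)"
      by (rule sum.swap)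
    finally show ?thesis .
  qed
  finally have "(1 / 2) * (\<Sum>i\<in>V. \<Sum>j\<in>V. \<bar>F i j\<bar>) \<le> (\<Sum>t\<in>T. \<Sum>i\<in>V. \<Sum>j\<in>V. G t i j)"
    by simp
  also have "\<dots> \<le> real (card T) * c"
    using cut by (intro sum_bounded_above)
  also have "\<dots> \<le> (real (card V) - 1) * c"
  proof (rule mult_right_mono)
    have "card T < card (r ` V)"
      unfolding T_def using fin ne by (intro card_Diff1_less) auto
    also have "card (r ` V) \<le> card V"
      using fin by (rule card_image_le)
    finally show "real (card T) \<le> real (card V) - 1"
      by linarith
    show "0 \<le> c"
      using outflow[of "{}"] by simp
  qed
  finally show ?thesis .
qed

section \<open>The flow attached to two columns of the inverse\<close>

text \<open>
  The quotient \<open>y / (x + y)\<close> measures the direction of a point of the first quadrant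
  and stays finite on the vertical axis, where \<open>y / x\<close> would not.  At the origin it takes the
  default value \<open>0\<close>; this is harmless, because both sides then vanish through the factor
  \<open>x + y\<close>.
\<close>

lemma cross_product_slope:
  fixes x y u v :: real
  assumes "0 \<le> x" "0 \<le> y" "0 \<le> u" "0 \<le> v"
  shows "x * v - u * y = (x + y) * (u + v) * (v / (u + v) - y / (x + y))"
proof -
  have 1: "(p + q) * (q / (p + q)) = q" if "0 \<le> p" "0 \<le> q" for p q :: real
    using that by (cases "p + q = 0") auto
  have "(x + y) * (u + v) * (v / (u + v) - y / (x + y))
      = (x + y) * ((u + v) * (v / (u + v))) - (u + v) * ((x + y) * (y / (x + y)))"
    by (simp add: algebra_simps del: times_divide_eq_right)
  also have "\<dots> = (x + y) * v - (u + v) * y"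
    using assms by (simp only: 1)
  finally show ?thesis
    by (simp add: algebra_simps)
qed

text \<open>
  By row \<open>i\<close> of \<open>M C = I\<close>, the outflow at \<open>i\<close> vanishes unless \<open>i\<close> is \<open>k\<close> or \<open>l\<close>.  The vertex \<open>k\<close>
  contributes \<open>c\<^sub>k\<^sub>l\<close>, and \<open>l\<close> contributes \<open>- c\<^sub>l\<^sub>k \<le> 0\<close>.
\<close>

lemma net_outflow_le:
  fixes M C :: "real ^ 'm ^ 'm"
  assumes inv: "M ** C = mat 1" and nonneg: "\<And>i j. 0 \<le> C $ i $ j"
  shows "(\<Sum>i\<in>S. \<Sum>j\<in>UNIV. - M $ i $ j * (C $ i $ k * C $ j $ l - C $ j $ k * C $ i $ l))
      \<le> C $ k $ l"
proof -
  have row: "(\<Sum>j\<in>UNIV. M $ i $ j * C $ j $ p) = (if i = p then 1 else 0)" for i p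
    using arg_cong[OF inv, of "\<lambda>A. A $ i $ p"] by (simp add: matrix_matrix_mult_def mat_def)
  have vertex: "(\<Sum>j\<in>UNIV. - M $ i $ j * (C $ i $ k * C $ j $ l - C $ j $ k * C $ i $ l))
      = (if i = k then C $ k $ l else 0) - (if i = l then C $ l $ k else 0)" for i
  proof -
    have "(\<Sum>j\<in>UNIV. - M $ i $ j * (C $ i $ k * C $ j $ l - C $ j $ k * C $ i $ l))
        = C $ i $ l * (\<Sum>j\<in>UNIV. M $ i $ j * C $ j $ k)
          - C $ i $ k * (\<Sum>j\<in>UNIV. M $ i $ j * C $ j $ l)"
      by (simp add: sum_distrib_left sum_subtractf[symmetric] algebra_simps)
    then show ?thesis
      by (simp add: row)
  qed
  show ?thesis
    unfolding vertex using nonneg[of k l] nonneg[of l k] by (simp add: sum_subtractf)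
qed

theorem theorem6p1:
  fixes M C :: "real ^ 'm ^ 'm"
  assumes "CARD('m) \<ge> 2"
    and "transpose M = M"
    and "invertible M"
    and "nonpos_off_diagonal M"
    and "C = matrix_inv M"
    and "M_matrix M"
  shows "\<forall>k l. k \<noteq> l \<longrightarrow>
    (1 / 2) * (\<Sum>i\<in>UNIV. \<Sum>j\<in>UNIV.
        \<bar>M $ i $ j\<bar> * \<bar>C $ i $ k * C $ j $ l - C $ j $ k * C $ i $ l\<bar>)
      \<le> (real CARD('m) - 1) * C $ k $ l"
proof (intro allI impI)
  fix k l :: 'm
  have nonneg: "0 \<le> C $ i $ j" for i j
    using assms(5,6) by (simp add: M_matrix_def)
  have off: "M $ i $ j \<le> 0" if "i \<noteq> j" for i j
    using assms(4) that by (simp add: nonpos_off_diagonal_def)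
  have sym: "M $ j $ i = M $ i $ j" for i j
    using arg_cong[OF assms(2), of "\<lambda>A. A $ i $ j"] by (simp add: transpose_def)
  have inv: "M ** C = mat 1"
    using someI_ex[OF assms(3)[unfolded invertible_def]] assms(5) by (simp add: matrix_inv_def)
  define D where "D i j = C $ i $ k * C $ j $ l - C $ j $ k * C $ i $ l" for i j
  define F where "F i j = - M $ i $ j * D i j" for i j
  define r where "r i = C $ i $ l / (C $ i $ k + C $ i $ l)" for i
  have D_eq: "D i j = (C $ i $ k + C $ i $ l) * (C $ j $ k + C $ j $ l) * (r j - r i)" for i j
    unfolding D_def r_def by (intro cross_product_slope nonneg)
  have "(1 / 2) * (\<Sum>i\<in>UNIV. \<Sum>j\<in>UNIV. \<bar>F i j\<bar>) \<le> (real CARD('m) - 1) * C $ k $ l"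
  proof (rule mass_of_flow_along_potential[where r = r])
    show "F j i = - F i j" for i j
      by (simp add: F_def D_def sym[of i j] algebra_simps)
    show "0 \<le> F i j" if "r i < r j" for i j
    proof -
      have "i \<noteq> j"
        using that by auto
      moreover have "0 \<le> D i j"
        unfolding D_eq using that nonneg by (intro mult_nonneg_nonneg add_nonneg_nonneg) auto
      ultimately show ?thesis
        using off by (simp add: F_def mult_nonpos_nonneg)
    qed
    show "F i j = 0" if "r i = r j" for i j
      using that by (simp add: F_def D_eq)
    show "(\<Sum>i\<in>S. \<Sum>j\<in>UNIV. F i j) \<le> C $ k $ l" for S
      unfolding F_def D_def using inv nonneg by (rule net_outflow_le)
  qed simp_all
  then show "(1 / 2) * (\<Sum>i\<in>UNIV. \<Sum>j\<in>UNIV.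
        \<bar>M $ i $ j\<bar> * \<bar>C $ i $ k * C $ j $ l - C $ j $ k * C $ i $ l\<bar>)
      \<le> (real CARD('m) - 1) * C $ k $ l"
    by (simp add: F_def D_def abs_mult)
qed

end
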